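(* Let $\alpha \in \mathbb{R}$ and let $Z \sim BASN_2(\alpha)$. Then the cumulative distribution function of $Z$ is given, for all $z \in \mathbb{R}$, by $$F_Z(z;\alpha) = \Phi(z) + \frac{\alpha\{8 - 8\alpha z + 4\alpha^2(2+z^2) - \alpha^3 z(3+z^2)\}}{C_2(\alpha)(2+\alpha^2)^2}\,\varphi(z).$$
   Context: Here $\varphi(z) = \frac{1}{\sqrt{2\pi}} e^{-z^2/2}$ and $\Phi$ are the probability density function and the cumulative distribution function of the standard normal distribution. For $\alpha\in\mathbb{R}$, put $C_2(\alpha) = 3 - \frac{4}{2+\alpha^2}$. A real random variable $Z$ follows the Balakrishnan alpha skew normal distribution with parameter $\alpha$, written $Z\sim BASN_2(\alpha)$, if it has the probability density function $$f_Z(z;\alpha) = \frac{1}{C_2(\alpha)}\left(\frac{(1-\alpha z)^2+1}{2+\alpha^2}\right)^2\varphi(z),\qquad z\in\mathbb{R}.$$ *)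

theory Defs
  imports "HOL-Probability.Probability"
begin

abbreviation std_normal_cdf :: "real \<Rightarrow> real" where
  "std_normal_cdf \<equiv> cdf std_normal_distribution"

definition C2 :: "real \<Rightarrow> real" where
  "C2 \<alpha> = 3 - 4 / (2 + \<alpha>\<^sup>2)"

definition basn2_density :: "real \<Rightarrow> real \<Rightarrow> real" where
  "basn2_density \<alpha> z =
     1 / C2 \<alpha> * (((1 - \<alpha> * z)\<^sup>2 + 1) / (2 + \<alpha>\<^sup>2))\<^sup>2 * std_normal_density z"

(* ennreal truncates negative reals to 0; this has no effect here, since C2 is at least 1. *)
definition basn2_distributed :: "'a measure \<Rightarrow> ('a \<Rightarrow> real) \<Rightarrow> real \<Rightarrow> bool" where
  "basn2_distributed M Z \<alpha> \<longleftrightarrow> distributed M lborel Z (\<lambda>z. ennreal (basn2_density \<alpha> z))"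

end

theory Submission
  imports Defs "HOL-Real_Asymp.Real_Asymp"
begin

text \<open>
  The correction term in the claimed distribution function has the form \<open>G z = Q z / D * \<phi> z\<close>,
  where \<open>\<phi>\<close> is the standard normal density, \<open>Q\<close> is a polynomial in \<open>z\<close> and
  \<open>D = C2 \<alpha> * (2 + \<alpha>\<^sup>2)\<^sup>2\<close>. Since \<open>\<phi>' z = - z * \<phi> z\<close>, its derivative is
  \<open>(Q' z - z * Q z) / D * \<phi> z\<close>. The normalising constant is \<open>D = 4 + 8 * \<alpha>\<^sup>2 + 3 * \<alpha> ^ 4\<close>,
  and comparing coefficients gives
  \<open>Q' z - z * Q z = ((1 - \<alpha> * z)\<^sup>2 + 1)\<^sup>2 - D\<close>. Hence \<open>G\<close> is an antiderivative of the difference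
  of the two densities (\<open>basn2_correction_has_derivative\<close>).

  As \<open>\<phi>\<close> decays faster than any polynomial grows, \<open>G\<close> vanishes at \<open>-\<infinity>\<close>
  (\<open>basn2_correction_tendsto_0\<close>). Integrating the difference of the densities
  over \<open>{..z}\<close> therefore yields exactly \<open>G z\<close>
  (\<open>cdf_density_eq_cdf_density_plus_antiderivative\<close>).
\<close>

lemma cdf_density_lborel:
  fixes f :: "real \<Rightarrow> real"
  assumes f: "integrable lborel f" and nonneg: "\<And>x. 0 \<le> f x"
  shows "cdf (density lborel (\<lambda>x. ennreal (f x))) z = (LINT x:{..z}|lborel. f x)"
proof -
  have [measurable]: "f \<in> borel_measurable borel"
    using borel_measurable_integrable[OF f] by simp
  have "emeasure (density lborel (\<lambda>x. ennreal (f x))) {..z}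
      = (\<integral>\<^sup>+x. ennreal (indicator {..z} x * f x) \<partial>lborel)"
    by (subst emeasure_density) (auto intro!: nn_integral_cong split: split_indicator)
  then show ?thesis
    unfolding cdf_def measure_def set_lebesgue_integral_def
    by (simp add: nonneg integral_eq_nn_integral)
qed

text \<open>
  The fundamental theorem of calculus on \<open>{..z}\<close>, applied to the difference \<open>f - g\<close>:
  this compares two distribution functions even when neither density has an elementary
  antiderivative.
\<close>

lemma cdf_density_eq_cdf_density_plus_antiderivative:
  fixes f g G :: "real \<Rightarrow> real"
  assumes f: "integrable lborel f" "\<And>x. 0 \<le> f x" "\<And>x. isCont f x"
    and g: "integrable lborel g" "\<And>x. 0 \<le> g x" "\<And>x. isCont g x"
    and deriv: "\<And>x. (G has_real_derivative f x - g x) (at x)"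
    and lim: "(G \<longlongrightarrow> 0) at_bot"
  shows "cdf (density lborel (\<lambda>x. ennreal (f x))) z
       = cdf (density lborel (\<lambda>x. ennreal (g x))) z + G z"
proof -
  have set_int: "set_integrable lborel A f" "set_integrable lborel A g"
    if "A \<in> sets borel" for A
    using that f(1) g(1) unfolding set_integrable_def
    by (simp_all add: integrable_mult_indicator del: real_scaleR_def)
  have "(LBINT x=-\<infinity>..ereal z. f x - g x) = G z - 0"
  proof (rule interval_integral_FTC_integrable)
    show "((G \<circ> real_of_ereal) \<longlongrightarrow> 0) (at_right (- \<infinity>))"
      using lim by (simp add: ereal_tendsto_simps)
    show "((G \<circ> real_of_ereal) \<longlongrightarrow> G z) (at_left (ereal z))"
      using DERIV_isCont[OF deriv[of z]]
      by (simp add: ereal_tendsto_simps isCont_def filterlim_at_split)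
    show "set_integrable lborel (einterval (- \<infinity>) (ereal z)) (\<lambda>x. f x - g x)"
      by (intro set_integral_diff set_int) auto
  qed (auto intro!: deriv continuous_intros f g
         simp flip: has_real_derivative_iff_has_vector_derivative)
  \<comment> \<open>The interval integral is over the open ray; the end point is a null set.\<close>
  moreover have "(LBINT x=-\<infinity>..ereal z. f x - g x) = (LINT x:{..z}|lborel. f x - g x)"
  proof -
    have "(LINT x:{..<z}|lborel. f x - g x) = (LINT x:{..z}|lborel. f x - g x)"
      unfolding set_lebesgue_integral_def
    proof (rule integral_cong_AE)
      show "AE x in lborel. indicator {..<z} x *\<^sub>R (f x - g x)
          = indicator {..z} x *\<^sub>R (f x - g x)"
        using AE_lborel_singleton[of z] by eventually_elim (auto split: split_indicator)
    qed (use f(1) g(1) in auto)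
    then show ?thesis
      by (simp add: interval_lebesgue_integral_def)
  qed
  ultimately have "(LINT x:{..z}|lborel. f x) - (LINT x:{..z}|lborel. g x) = G z"
    by (simp add: set_integral_diff(2) set_int)
  then show ?thesis
    by (simp add: cdf_density_lborel f g)
qed

lemma C2_ge_1: "1 \<le> C2 \<alpha>"
  unfolding C2_def by (simp add: field_simps add_pos_nonneg)

lemma C2_normalising_constant: "C2 \<alpha> * (2 + \<alpha>\<^sup>2)\<^sup>2 = 4 + 8 * \<alpha>\<^sup>2 + 3 * \<alpha> ^ 4"
proof -
  have "2 + \<alpha>\<^sup>2 \<noteq> 0"
    by (metis add_pos_nonneg less_irrefl zero_le_power2 zero_less_numeral)
  then have "C2 \<alpha> * (2 + \<alpha>\<^sup>2)\<^sup>2 = 3 * (2 + \<alpha>\<^sup>2)\<^sup>2 - 4 * (2 + \<alpha>\<^sup>2)"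
    unfolding C2_def by (simp add: field_simps power2_eq_square)
  also have "\<dots> = 4 + 8 * \<alpha>\<^sup>2 + 3 * \<alpha> ^ 4"
    by algebra
  finally show ?thesis .
qed

lemma basn2_density_alt:
  "basn2_density \<alpha> z
     = ((1 - \<alpha> * z)\<^sup>2 + 1)\<^sup>2 / (C2 \<alpha> * (2 + \<alpha>\<^sup>2)\<^sup>2) * std_normal_density z"
  by (simp add: basn2_density_def power_divide)

lemma basn2_density_nonneg: "0 \<le> basn2_density \<alpha> z"
  using C2_ge_1[of \<alpha>] by (simp add: basn2_density_def)

lemma has_derivative_std_normal_density:
  "(std_normal_density has_real_derivative - z * std_normal_density z) (at z)"
  unfolding normal_density_def
  by (auto intro!: derivative_eq_intros simp: field_simps)

lemma isCont_basn2_density: "isCont (basn2_density \<alpha>) z"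
proof -
  have "isCont std_normal_density z"
    by (rule DERIV_isCont[OF has_derivative_std_normal_density])
  then show ?thesis
    unfolding basn2_density_def by (intro continuous_intros) (auto simp: add_nonneg_eq_0_iff)
qed

lemma integrable_basn2_density: "integrable lborel (basn2_density \<alpha>)"
proof -
  define D where "D = C2 \<alpha> * (2 + \<alpha>\<^sup>2)\<^sup>2"
  \<comment> \<open>Up to the factor \<open>1 / D\<close> the density is a combination of normal moment integrands.\<close>
  have expand: "((1 - \<alpha> * z)\<^sup>2 + 1)\<^sup>2 * std_normal_density z
      = 4 * (std_normal_density z * z ^ 0) - 8 * \<alpha> * (std_normal_density z * z ^ 1)
        + 8 * \<alpha>\<^sup>2 * (std_normal_density z * z ^ 2) - 4 * \<alpha> ^ 3 * (std_normal_density z * z ^ 3)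
        + \<alpha> ^ 4 * (std_normal_density z * z ^ 4)" for z
    unfolding power_0 power_one_right by algebra
  have "integrable lborel (\<lambda>z. ((1 - \<alpha> * z)\<^sup>2 + 1)\<^sup>2 * std_normal_density z)"
    unfolding expand
    by (intro Bochner_Integration.integrable_add Bochner_Integration.integrable_diff
          integrable_mult_right integrable_std_normal_moment)
  then have "integrable lborel (\<lambda>z. ((1 - \<alpha> * z)\<^sup>2 + 1)\<^sup>2 * std_normal_density z / D)"
    by (rule integrable_divide)
  then show ?thesis
    by (simp add: basn2_density_alt[abs_def] D_def)
qed

definition basn2_correction :: "real \<Rightarrow> real \<Rightarrow> real" where
  "basn2_correction \<alpha> z =
     \<alpha> * (8 - 8 * \<alpha> * z + 4 * \<alpha>\<^sup>2 * (2 + z\<^sup>2) - \<alpha> ^ 3 * z * (3 + z\<^sup>2))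
       / (C2 \<alpha> * (2 + \<alpha>\<^sup>2)\<^sup>2) * std_normal_density z"

text \<open>
  After cancelling \<open>std_normal_density z\<close> this is the polynomial identity
  \<open>Q' - z * Q = ((1 - \<alpha> * z)\<^sup>2 + 1)\<^sup>2 - D\<close>; the value of \<open>D\<close> makes the constant terms agree.
\<close>

lemma basn2_correction_has_derivative:
  "(basn2_correction \<alpha> has_real_derivative basn2_density \<alpha> z - std_normal_density z) (at z)"
proof -
  define D where "D = C2 \<alpha> * (2 + \<alpha>\<^sup>2)\<^sup>2"
  define Q where "Q = (\<lambda>z. \<alpha> * (8 - 8 * \<alpha> * z + 4 * \<alpha>\<^sup>2 * (2 + z\<^sup>2) - \<alpha> ^ 3 * z * (3 + z\<^sup>2)))"
  define Q' where "Q' = - 8 * \<alpha>\<^sup>2 + 8 * \<alpha> ^ 3 * z - 3 * \<alpha> ^ 4 - 3 * \<alpha> ^ 4 * z\<^sup>2"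
  have D: "D = 4 + 8 * \<alpha>\<^sup>2 + 3 * \<alpha> ^ 4"
    unfolding D_def by (rule C2_normalising_constant)
  have "D > 0"
    unfolding D by (simp add: add_pos_nonneg)
  have "(Q has_real_derivative Q') (at z)"
    unfolding Q_def Q'_def
    by (rule derivative_eq_intros refl)+ (simp, algebra)
  then have "((\<lambda>z. Q z / D * std_normal_density z) has_real_derivative
      Q' / D * std_normal_density z + - z * std_normal_density z * (Q z / D)) (at z)"
    by (intro DERIV_mult has_derivative_std_normal_density DERIV_cdivide)
  moreover have "Q' / D * std_normal_density z + - z * std_normal_density z * (Q z / D)
      = (Q' - z * Q z) / D * std_normal_density z"
    by (simp add: diff_divide_distrib algebra_simps)
  moreover have "Q' - z * Q z = ((1 - \<alpha> * z)\<^sup>2 + 1)\<^sup>2 - D"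
    unfolding Q_def Q'_def D by algebra
  moreover have "(((1 - \<alpha> * z)\<^sup>2 + 1)\<^sup>2 - D) / D * std_normal_density z
      = basn2_density \<alpha> z - std_normal_density z"
    using \<open>D > 0\<close> unfolding basn2_density_alt D_def[symmetric]
    by (simp add: diff_divide_distrib left_diff_distrib)
  ultimately show ?thesis
    unfolding basn2_correction_def[abs_def] Q_def D_def by simp
qed

lemma basn2_correction_tendsto_0: "(basn2_correction \<alpha> \<longlongrightarrow> 0) at_bot"
proof -
  have moment: "((\<lambda>z. z ^ k * std_normal_density z) \<longlongrightarrow> 0) at_bot" for k
    unfolding std_normal_density_def by real_asymp
  define D where "D = C2 \<alpha> * (2 + \<alpha>\<^sup>2)\<^sup>2"
  have "basn2_correction \<alpha> = (\<lambda>z.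
      (8 * \<alpha> + 8 * \<alpha> ^ 3) / D * (z ^ 0 * std_normal_density z)
      - (8 * \<alpha>\<^sup>2 + 3 * \<alpha> ^ 4) / D * (z ^ 1 * std_normal_density z)
      + 4 * \<alpha> ^ 3 / D * (z ^ 2 * std_normal_density z)
      - \<alpha> ^ 4 / D * (z ^ 3 * std_normal_density z))"
    unfolding basn2_correction_def D_def[symmetric]
    by (rule ext) (simp add: divide_inverse power2_eq_square power3_eq_cube power4_eq_xxxx
        algebra_simps)
  moreover have "((\<lambda>z.
      (8 * \<alpha> + 8 * \<alpha> ^ 3) / D * (z ^ 0 * std_normal_density z)
      - (8 * \<alpha>\<^sup>2 + 3 * \<alpha> ^ 4) / D * (z ^ 1 * std_normal_density z)
      + 4 * \<alpha> ^ 3 / D * (z ^ 2 * std_normal_density z)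
      - \<alpha> ^ 4 / D * (z ^ 3 * std_normal_density z)) \<longlongrightarrow>
      (8 * \<alpha> + 8 * \<alpha> ^ 3) / D * 0 - (8 * \<alpha>\<^sup>2 + 3 * \<alpha> ^ 4) / D * 0
      + 4 * \<alpha> ^ 3 / D * 0 - \<alpha> ^ 4 / D * 0) at_bot"
    by (intro tendsto_intros moment)
  ultimately show ?thesis
    by simp
qed

theorem proposition1:
  fixes M :: "'a measure" and Z :: "'a \<Rightarrow> real" and \<alpha> :: real
  assumes "prob_space M"
    and "basn2_distributed M Z \<alpha>"
  shows "\<forall>z::real. cdf (distr M borel Z) z =
    std_normal_cdf z +
    \<alpha> * (8 - 8 * \<alpha> * z + 4 * \<alpha>\<^sup>2 * (2 + z\<^sup>2) - \<alpha> ^ 3 * z * (3 + z\<^sup>2))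
      / (C2 \<alpha> * (2 + \<alpha>\<^sup>2)\<^sup>2) * std_normal_density z"
proof
  fix z :: real
  have "distr M borel Z = distr M lborel Z"
    by (rule distr_cong) auto
  also have "\<dots> = density lborel (\<lambda>z. ennreal (basn2_density \<alpha> z))"
    using assms(2) unfolding basn2_distributed_def by (rule distributed_distr_eq_density)
  finally have "cdf (distr M borel Z) z = std_normal_cdf z + basn2_correction \<alpha> z"
    by (simp add: cdf_density_eq_cdf_density_plus_antiderivative[OF
          integrable_basn2_density basn2_density_nonneg isCont_basn2_density
          integrable_normal_density normal_density_nonneg
          DERIV_isCont[OF has_derivative_std_normal_density]
          basn2_correction_has_derivative basn2_correction_tendsto_0])
  then show "cdf (distr M borel Z) z =
    std_normal_cdf z +
    \<alpha> * (8 - 8 * \<alpha> * z + 4 * \<alpha>\<^sup>2 * (2 + z\<^sup>2) - \<alpha> ^ 3 * z * (3 + z\<^sup>2))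
      / (C2 \<alpha> * (2 + \<alpha>\<^sup>2)\<^sup>2) * std_normal_density z"
    unfolding basn2_correction_def .
qed

end
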